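(* Let $A\in\mathbb{C}^{n\times n}$ with $\operatorname{rk}A^{2}=\operatorname{rk}A=s\ge 1$. (1) The right core inverse $X=(x_{ij})$ of $A$ has, for all $i,j$, the determinantal representations $$x_{ij}=\frac{\sum_{\alpha\in I_{s,n}\{j\}}\left|(AA^{*})_{j.}(v_{i.})\right|_{\alpha}^{\alpha}}{\sum_{\alpha\in I_{s,n}}|AA^{*}|_{\alpha}^{\alpha}\ \sum_{\beta\in J_{s,n}}|A^{2}|_{\beta}^{\beta}}=\frac{\sum_{\beta\in J_{s,n}\{i\}}\left|(A^{2})_{.i}(v_{.j})\right|_{\beta}^{\beta}}{\sum_{\alpha\in I_{s,n}}|AA^{*}|_{\alpha}^{\alpha}\ \sum_{\beta\in J_{s,n}}|A^{2}|_{\beta}^{\beta}},$$ where $$v_{i.}=\Big[\sum_{\beta\in J_{s,n}\{i\}}\left|(A^{2})_{.i}(\tilde a_{.f})\right|_{\beta}^{\beta}\Big]_{f=1,\dots,n}\in\mathbb{C}^{1\times n},\qquad v_{.j}=\Big[\sum_{\alpha\in I_{s,n}\{j\}}\left|(AA^{*})_{j.}(\tilde a_{l.})\right|_{\alpha}^{\alpha}\Big]_{l=1,\dots,n}\in\mathbb{C}^{n\times 1}$$ are a row vector and a column vector, respectively, and $\tilde a_{.f}$, $\tilde a_{l.}$ are the $f$th column and the $l$th row of $\tilde A:=A^{2}A^{*}$. (2) The left core inverse $Y=(y_{ij})$ of $A$ has, for all $i,j$, the determinantal representations $$y_{ij}=\frac{\sum_{\alpha\in I_{s,n}\{j\}}\left|(A^{2})_{j.}(u_{i.})\right|_{\alpha}^{\alpha}}{\sum_{\alpha\in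 I_{s,n}}|A^{2}|_{\alpha}^{\alpha}\ \sum_{\beta\in J_{s,n}}|A^{*}A|_{\beta}^{\beta}}=\frac{\sum_{\beta\in J_{s,n}\{i\}}\left|(A^{*}A)_{.i}(u_{.j})\right|_{\beta}^{\beta}}{\sum_{\alpha\in I_{s,n}}|A^{2}|_{\alpha}^{\alpha}\ \sum_{\beta\in J_{s,n}}|A^{*}A|_{\beta}^{\beta}},$$ where $$u_{i.}=\Big[\sum_{\beta\in J_{s,n}\{i\}}\left|(A^{*}A)_{.i}(\bar a_{.f})\right|_{\beta}^{\beta}\Big]_{f=1,\dots,n}\in\mathbb{C}^{1\times n},\qquad u_{.j}=\Big[\sum_{\alpha\in I_{s,n}\{j\}}\left|(A^{2})_{j.}(\bar a_{l.})\right|_{\alpha}^{\alpha}\Big]_{l=1,\dots,n}\in\mathbb{C}^{n\times 1}$$ are a row vector and a column vector, respectively, and $\bar a_{.f}$, $\bar a_{l.}$ are the $f$th column and the $l$th row of $\bar A:=A^{*}A^{2}$.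
   Context: $A^{*}$ is the conjugate transpose and $A^{\dagger}$ the Moore-Penrose inverse. For $A\in\mathbb{C}^{n\times n}$ the right core inverse is the matrix $X$ with $AX=AA^{\dagger}$ and $\mathcal{R}_r(X)=\mathcal{R}_r(A)$, where $\mathcal{R}_r(A)=\{Ax:x\in\mathbb{C}^{n\times1}\}$; the left core inverse is the matrix $Y$ with $YA=A^{\dagger}A$ and $\mathcal{R}_l(Y)=\mathcal{R}_l(A)$, where $\mathcal{R}_l(A)=\{xA:x\in\mathbb{C}^{1\times n}\}$. Both exist if and only if $\operatorname{rk}A^2=\operatorname{rk}A$. For $1\le k\le n$, $I_{k,n}=J_{k,n}$ is the set of all $k$-element subsets of $\{1,\dots,n\}$, and $I_{k,n}\{j\}=J_{k,n}\{j\}$ is the collection of those containing $j$. For a square matrix $M$, $|M|_\alpha^\alpha$ is the determinant of the principal submatrix of $M$ with rows and columns indexed by $\alpha$. $M_{j.}(b)$ is $M$ with its $j$th row replaced by the row $b$, $M_{.i}(c)$ is $M$ with its $i$th column replaced by the column $c$, and $|M_{j.}(b)|_\alpha^\alpha$, $|M_{.i}(c)|_\beta^\beta$ denote the corresponding principal minors of the modified matrices. *)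

theory Defs
  imports
    Complex_Main
    "Jordan_Normal_Form.DL_Rank"
    "Jordan_Normal_Form.DL_Submatrix"
    "Jordan_Normal_Form.Schur_Decomposition"
begin

text \<open>Matrix indices run over \<open>{0..<n}\<close>, following \<open>Jordan_Normal_Form\<close>; the conjugate transpose
  is its \<^const>\<open>mat_adjoint\<close>.\<close>

section \<open>Moore--Penrose inverse and core inverses\<close>

definition is_mp_inverse :: "complex mat \<Rightarrow> complex mat \<Rightarrow> bool" where
  "is_mp_inverse A X \<longleftrightarrow>
     X \<in> carrier_mat (dim_col A) (dim_row A) \<and>
     A * X * A = A \<and>
     X * A * X = X \<and>
     mat_adjoint (A * X) = A * X \<and>
     mat_adjoint (X * A) = X * A"

definition mp_inverse :: "complex mat \<Rightarrow> complex mat" where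
  "mp_inverse A = (THE X. is_mp_inverse A X)"

text \<open>Elements of \<open>\<complex>\<^bsup>n\<times>1\<^esup>\<close> and \<open>\<complex>\<^bsup>1\<times>n\<^esup>\<close> are one-column and one-row matrices here.\<close>

definition right_range :: "complex mat \<Rightarrow> complex mat set" where
  "right_range A = {A * x | x. x \<in> carrier_mat (dim_col A) 1}"

definition left_range :: "complex mat \<Rightarrow> complex mat set" where
  "left_range A = {x * A | x. x \<in> carrier_mat 1 (dim_row A)}"

text \<open>The next four definitions are meant for square \<open>A\<close>. The core inverses exist iff \<open>A\<^sup>2\<close> and \<open>A\<close>
  have equal rank; otherwise the description operator returns an unspecified matrix.\<close>

definition is_right_core_inverse :: "complex mat \<Rightarrow> complex mat \<Rightarrow> bool" where
  "is_right_core_inverse A X \<longleftrightarrow>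
     X \<in> carrier_mat (dim_row A) (dim_col A) \<and>
     A * X = A * mp_inverse A \<and> right_range X = right_range A"

definition right_core_inverse :: "complex mat \<Rightarrow> complex mat" where
  "right_core_inverse A = (THE X. is_right_core_inverse A X)"

definition is_left_core_inverse :: "complex mat \<Rightarrow> complex mat \<Rightarrow> bool" where
  "is_left_core_inverse A Y \<longleftrightarrow>
     Y \<in> carrier_mat (dim_row A) (dim_col A) \<and>
     Y * A = mp_inverse A * A \<and> left_range Y = left_range A"

definition left_core_inverse :: "complex mat \<Rightarrow> complex mat" where
  "left_core_inverse A = (THE Y. is_left_core_inverse A Y)"

section \<open>Principal minors\<close>

definition ksubsets :: "nat \<Rightarrow> nat \<Rightarrow> nat set set" where
  "ksubsets k n = {\<alpha>. \<alpha> \<subseteq> {0..<n} \<and> card \<alpha> = k}"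

definition ksubsets_containing :: "nat \<Rightarrow> nat \<Rightarrow> nat \<Rightarrow> nat set set" where
  "ksubsets_containing k n j = {\<alpha> \<in> ksubsets k n. j \<in> \<alpha>}"

definition principal_minor :: "'a :: comm_ring_1 mat \<Rightarrow> nat set \<Rightarrow> 'a" where
  "principal_minor M \<alpha> = det (submatrix M \<alpha> \<alpha>)"

text \<open>Row analogue of \<^const>\<open>replace_col\<close>, with the same argument order (the index comes last).\<close>

definition replace_row :: "'a mat \<Rightarrow> 'a vec \<Rightarrow> nat \<Rightarrow> 'a mat" where
  "replace_row M b j =
     mat (dim_row M) (dim_col M) (\<lambda>(k, l). if k = j then b $ l else M $$ (k, l))"

end

theory Submission
  imports Defs
begin

text \<open>Comparing the coefficients of \<open>det (x I + P Q)\<close> and \<open>det (x I + Q P)\<close> shows that the principal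
  \<open>s\<close>-minors of a product \<open>P Q\<close> with inner dimension \<open>s\<close> sum up to \<open>det (Q P)\<close>. Replacing column
  \<open>i\<close> of \<open>M = P Q\<close> by \<open>M y\<close> is a rank one perturbation of \<open>Q\<close>, so the matrix determinant lemma yields a
  Cramer rule: the principal \<open>s\<close>-minors through \<open>i\<close> sum up to \<open>det (Q P)\<close> times the \<open>i\<close>-th entry of
  \<open>P (Q P)\<^sup>-\<^sup>1 Q y\<close>. Given a rank factorization \<open>A = P Q\<close>, this applies to \<open>A\<^sup>2\<close>, \<open>A A\<^sup>*\<close> and \<open>A\<^sup>* A\<close>, each of
  which inherits a factorization with inner dimension \<open>s\<close>. The core inverses are
  \<open>P (Q P)\<^sup>-\<^sup>1 (P\<^sup>* P)\<^sup>-\<^sup>1 P\<^sup>*\<close> and \<open>Q\<^sup>* (Q Q\<^sup>*)\<^sup>-\<^sup>1 (Q P)\<^sup>-\<^sup>1 Q\<close>.\<close>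

section \<open>Sums of principal minors\<close>

lemma mult_mat_zero_vec:
  fixes A :: "'a :: semiring_0 mat"
  shows "A \<in> carrier_mat n m \<Longrightarrow> A *\<^sub>v 0\<^sub>v m = 0\<^sub>v n"
  by (intro eq_vecI) (auto simp: scalar_prod_def)

lemma mult_mat_unit_vec:
  fixes A :: "'a :: semiring_1 mat"
  shows "A \<in> carrier_mat n m \<Longrightarrow> k < m \<Longrightarrow> A *\<^sub>v unit_vec m k = col A k"
  by (intro eq_vecI) (auto simp: scalar_prod_right_unit)

lemma mult_mat_assoc:
  fixes A B C :: "'a :: semiring_0 mat"
  shows "dim_col A = dim_row B \<Longrightarrow> dim_col B = dim_row C \<Longrightarrow> A * B * C = A * (B * C)"
  by (rule assoc_mult_mat[of _ "dim_row A" "dim_col A" _ "dim_col B" _ "dim_col C"]) auto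

text \<open>\<open>pick \<beta>\<close> maps the positions \<open>0..<k\<close> bijectively onto
  \<beta>, and conjugation by it carries permutations of the positions to permutations of \<beta>
  with the same sign. Freed from renumbered indices, minors can be recognized inside the expansion
  of a larger determinant.\<close>

lemma principal_minor_leibniz:
  fixes M :: "'a :: comm_ring_1 mat"
  assumes M: "M \<in> carrier_mat n n" and b: "\<beta> \<subseteq> {0..<n}"
  shows "principal_minor M \<beta> =
    (\<Sum>p | p permutes \<beta>. signof p * (\<Prod>i\<in>\<beta>. M $$ (i, p i)))"
proof -
  define k where "k = card \<beta>"
  have fin: "finite \<beta>" using b finite_subset by blast
  have "{i. i < n \<and> i \<in> \<beta>} = \<beta>" using b by auto
  then have sub: "submatrix M \<beta> \<beta> = mat k k (\<lambda>(i, j). M $$ (pick \<beta> i, pick \<beta> j))"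
    using M unfolding submatrix_def k_def by simp
  let ?f = "pick \<beta>" and ?A = "{0..<k}"
  have inj: "inj_on ?f ?A"
  proof (rule linorder_inj_onI)
    fix x y assume "x < y" "x \<in> ?A" "y \<in> ?A"
    then show "?f x \<noteq> ?f y" using pick_mono[of y \<beta> x] by (simp add: k_def)
  qed auto
  have "?f ` ?A \<subseteq> \<beta>" using pick_in_set by (auto simp: k_def)
  moreover have "card (?f ` ?A) = card \<beta>" using card_image[OF inj] by (simp add: k_def)
  ultimately have im: "?f ` ?A = \<beta>" using fin by (simp add: card_subset_eq)
  have bij: "bij_betw ?f ?A \<beta>" using inj im by (simp add: bij_betw_def)
  let ?g = "map_permutation ?A ?f"
  have g: "?g = (\<lambda>p x. if x \<in> \<beta> then ?f (p (inv_into ?A ?f x)) else x)"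
    by (auto simp: map_permutation_def restrict_id_def im fun_eq_iff)
  have bg: "bij_betw ?g {p. p permutes ?A} {p. p permutes \<beta>}"
    unfolding g by (rule bij_betw_permutations[OF bij])
  have "(\<Sum>p | p permutes \<beta>. signof p * (\<Prod>i\<in>\<beta>. M $$ (i, p i)))
      = (\<Sum>p | p permutes ?A. signof (?g p) * (\<Prod>i\<in>\<beta>. M $$ (i, ?g p i)))"
    by (rule sum.reindex_bij_betw[OF bg, symmetric])
  also have "\<dots> = (\<Sum>p | p permutes ?A. signof p * (\<Prod>i\<in>?A. M $$ (?f i, ?f (p i))))"
  proof (rule sum.cong[OF refl])
    fix p assume "p \<in> {p. p permutes ?A}"
    then have p: "p permutes ?A" by simp
    have s: "sign (?g p) = sign p"
      by (rule sign_map_permutation) (use inj p in auto)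
    have "(\<Prod>i\<in>\<beta>. M $$ (i, ?g p i)) = (\<Prod>i\<in>?A. M $$ (?f i, ?g p (?f i)))"
      by (rule prod.reindex_bij_betw[OF bij, symmetric])
    also have "\<dots> = (\<Prod>i\<in>?A. M $$ (?f i, ?f (p i)))"
      by (rule prod.cong[OF refl]) (use im inj in \<open>auto simp: g\<close>)
    finally show "signof (?g p) * (\<Prod>i\<in>\<beta>. M $$ (i, ?g p i))
      = signof p * (\<Prod>i\<in>?A. M $$ (?f i, ?f (p i)))" using s by simp
  qed
  also have "\<dots> = det (submatrix M \<beta> \<beta>)"
    unfolding sub
    by (subst det_def'[of _ k])
      (auto intro!: sum.cong prod.cong arg_cong[where f = "\<lambda>x. _ * x"] simp: permutes_in_image
         dest: permutes_in_image)
  finally show ?thesis by (simp add: principal_minor_def)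
qed

text \<open>In the Leibniz expansion each factor is an entry of \<open>M\<close>, plus
  \<open>x\<close> at a fixed point of \<open>p\<close>. After multiplying out, \<beta> collects the
  rows whose factor comes from \<open>M\<close>; the other rows must be fixed by \<open>p\<close>,
  which leaves the Leibniz sum over the permutations of \<beta>.\<close>

lemma det_scalar_plus:
  fixes M :: "'a :: comm_ring_1 mat"
  assumes M: "M \<in> carrier_mat n n"
  shows "det (x \<cdot>\<^sub>m 1\<^sub>m n + M) =
    (\<Sum>\<beta>\<in>Pow {0..<n}. x ^ (n - card \<beta>) * principal_minor M \<beta>)"
proof -
  let ?N = "{0..<n}"
  let ?d = "\<lambda>p i. if p i = i then x else 0"
  have "det (x \<cdot>\<^sub>m 1\<^sub>m n + M) =
      (\<Sum>p | p permutes ?N. signof p * (\<Prod>i\<in>?N. M $$ (i, p i) + ?d p i))"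
    using M
    by (subst det_def'[of _ n])
      (auto intro!: sum.cong prod.cong arg_cong[where f = "\<lambda>x. _ * x"] dest: permutes_in_image
         simp: add.commute)
  also have "\<dots> = (\<Sum>p | p permutes ?N. \<Sum>\<beta>\<in>Pow ?N.
      signof p * (\<Prod>i\<in>\<beta>. M $$ (i, p i)) * (\<Prod>i\<in>?N - \<beta>. ?d p i))"
    by (subst prod_add) (simp_all add: sum_distrib_left mult.assoc)
  also have "\<dots> = (\<Sum>\<beta>\<in>Pow ?N. \<Sum>p | p permutes ?N.
      signof p * (\<Prod>i\<in>\<beta>. M $$ (i, p i)) * (\<Prod>i\<in>?N - \<beta>. ?d p i))"
    by (rule sum.swap)
  also have "\<dots> = (\<Sum>\<beta>\<in>Pow ?N. x ^ (n - card \<beta>) * principal_minor M \<beta>)"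
  proof (rule sum.cong[OF refl])
    fix \<beta> assume "\<beta> \<in> Pow ?N"
    then have b: "\<beta> \<subseteq> ?N" by simp
    then have fin: "finite \<beta>" by (rule finite_subset) simp
    have "(\<Sum>p | p permutes ?N. signof p * (\<Prod>i\<in>\<beta>. M $$ (i, p i)) * (\<Prod>i\<in>?N - \<beta>. ?d p i))
      = (\<Sum>p | p permutes \<beta>. signof p * (\<Prod>i\<in>\<beta>. M $$ (i, p i)) * (\<Prod>i\<in>?N - \<beta>. ?d p i))"
    proof (rule sum.mono_neutral_right)
      show "{p. p permutes \<beta>} \<subseteq> {p. p permutes ?N}" using b permutes_subset by blast
      \<comment> \<open>A permutation that does not permute \<beta> moves a point outside \<beta>,
        where its factor \<open>?d p i\<close> is 0.\<close>
      show "\<forall>p\<in>{p. p permutes ?N} - {p. p permutes \<beta>}.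
          signof p * (\<Prod>i\<in>\<beta>. M $$ (i, p i)) * (\<Prod>i\<in>?N - \<beta>. ?d p i) = 0"
      proof
        fix p assume p: "p \<in> {p. p permutes ?N} - {p. p permutes \<beta>}"
        then obtain i where "i \<in> ?N - \<beta>" "p i \<noteq> i"
          using permutes_superset[of p ?N \<beta>] by auto
        then have "(\<Prod>i\<in>?N - \<beta>. ?d p i) = 0" by (intro prod_zero) auto
        then show "signof p * (\<Prod>i\<in>\<beta>. M $$ (i, p i)) * (\<Prod>i\<in>?N - \<beta>. ?d p i) = 0" by simp
      qed
    qed (simp add: finite_permutations)
    also have "\<dots> = (\<Sum>p | p permutes \<beta>. x ^ (n - card \<beta>) * (signof p * (\<Prod>i\<in>\<beta>. M $$ (i, p i))))"
    proof (rule sum.cong[OF refl])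
      fix p assume "p \<in> {p. p permutes \<beta>}"
      then have "(\<Prod>i\<in>?N - \<beta>. ?d p i) = (\<Prod>i\<in>?N - \<beta>. x)"
        by (intro prod.cong) (auto dest: permutes_not_in)
      also have "\<dots> = x ^ (n - card \<beta>)" using b fin by (simp add: card_Diff_subset)
      finally show "signof p * (\<Prod>i\<in>\<beta>. M $$ (i, p i)) * (\<Prod>i\<in>?N - \<beta>. ?d p i)
        = x ^ (n - card \<beta>) * (signof p * (\<Prod>i\<in>\<beta>. M $$ (i, p i)))" by simp
    qed
    finally show "(\<Sum>p | p permutes ?N. signof p * (\<Prod>i\<in>\<beta>. M $$ (i, p i)) * (\<Prod>i\<in>?N - \<beta>. ?d p i))
      = x ^ (n - card \<beta>) * principal_minor M \<beta>"
      by (simp add: principal_minor_leibniz[OF M b] sum_distrib_left)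
  qed
  finally show ?thesis .
qed

text \<open>Block elimination in the matrix with rows \<open>(x I, - P)\<close> and \<open>(Q, I)\<close>, from the right and from the
  left.\<close>

lemma det_scalar_plus_mult_commute:
  fixes P Q :: "'a :: idom mat"
  assumes P: "P \<in> carrier_mat n s" and Q: "Q \<in> carrier_mat s n"
  shows "x ^ s * det (x \<cdot>\<^sub>m 1\<^sub>m n + P * Q) = x ^ n * det (x \<cdot>\<^sub>m 1\<^sub>m s + Q * P)"
proof -
  let ?B = "four_block_mat (x \<cdot>\<^sub>m 1\<^sub>m n) (- P) Q (1\<^sub>m s)"
  let ?R = "four_block_mat (1\<^sub>m n) (0\<^sub>m n s) (- Q) (1\<^sub>m s)"
  \<comment> \<open>The block \<open>x I\<close> in place of \<open>I\<close> clears the lower left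
    corner without dividing by \<open>x\<close>; its determinant is the factor
    \<open>x ^ s\<close>.\<close>
  let ?L = "four_block_mat (1\<^sub>m n) (0\<^sub>m n s) (- Q) (x \<cdot>\<^sub>m 1\<^sub>m s)"
  have B: "?B \<in> carrier_mat (n + s) (n + s)" using P Q by auto
  have "?B * ?R = four_block_mat (x \<cdot>\<^sub>m 1\<^sub>m n + P * Q) (- P) (0\<^sub>m s n) (1\<^sub>m s)"
    using P Q by (subst mult_four_block_mat[of _ n n _ s _ s _ _ n _ s]) auto
  then have "det (?B * ?R) = det (x \<cdot>\<^sub>m 1\<^sub>m n + P * Q)"
    using P Q by (simp add: det_four_block_mat_lower_left_zero[of _ n _ s])
  moreover have "det ?R = 1"
    using Q by (simp add: det_four_block_mat_upper_right_zero[of _ n _ s])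
  moreover have "det (?B * ?R) = det ?B * det ?R"
    by (rule det_mult[OF B]) (use Q in auto)
  ultimately have 1: "det ?B = det (x \<cdot>\<^sub>m 1\<^sub>m n + P * Q)" by simp
  have "?L * ?B = four_block_mat (x \<cdot>\<^sub>m 1\<^sub>m n) (- P) (0\<^sub>m s n) (x \<cdot>\<^sub>m 1\<^sub>m s + Q * P)"
    using P Q
    by (subst mult_four_block_mat[of _ n n _ s _ s _ _ n _ s])
      (auto simp: mult_smult_distrib mult_smult_assoc_mat
        uminus_add_minus_mat comm_add_mat[of _ s s])
  then have "det (?L * ?B) = x ^ n * det (x \<cdot>\<^sub>m 1\<^sub>m s + Q * P)"
    using P Q by (simp add: det_four_block_mat_lower_left_zero[of _ n _ s])
  moreover have "det ?L = x ^ s"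
    using Q by (simp add: det_four_block_mat_upper_right_zero[of _ n _ s])
  moreover have "det (?L * ?B) = det ?L * det ?B"
    by (rule det_mult[OF _ B]) (use Q in auto)
  ultimately show ?thesis using 1 by simp
qed

text \<open>As polynomials in \<open>x\<close>, \<open>det (x I + P Q)\<close> is
  \<open>x ^ (n - s)\<close> times \<open>det (x I + Q P)\<close>. The coefficient of
  \<open>x ^ (n - s)\<close> is the sum of the principal \<open>s\<close>-minors on one side and the
  constant term \<open>det (Q P)\<close> on the other.\<close>

lemma sum_principal_minors_mult:
  fixes P Q :: "'a :: {idom, ring_char_0} mat"
  assumes P: "P \<in> carrier_mat n s" and Q: "Q \<in> carrier_mat s n" and sn: "s \<le> n"
  shows "(\<Sum>\<beta>\<in>ksubsets s n. principal_minor (P * Q) \<beta>) = det (Q * P)"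
proof -
  have PQ: "P * Q \<in> carrier_mat n n" and QP: "Q * P \<in> carrier_mat s s" using P Q by auto
  let ?p = "\<lambda>n M. \<Sum>\<beta>\<in>Pow {0..<n}. monom (principal_minor M \<beta>) (n - card \<beta>)"
  have p: "poly (?p n M) x = det (x \<cdot>\<^sub>m 1\<^sub>m n + M)" if "M \<in> carrier_mat n n" for n x and M :: "'a mat"
    by (simp add: det_scalar_plus[OF that] poly_sum poly_monom mult.commute)
  have "monom 1 s * ?p n (P * Q) = monom 1 n * ?p s (Q * P)"
    \<comment> \<open>Characteristic 0 makes the domain infinite, so equal values everywhere give
      equal polynomials, in which \<open>x ^ s\<close> can be cancelled.\<close>
    by (subst poly_eq_poly_eq_iff[symmetric])
      (auto simp: fun_eq_iff p[OF PQ] p[OF QP] poly_monom det_scalar_plus_mult_commute[OF P Q])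
  also have "monom (1::'a) n = monom 1 s * monom 1 (n - s)" using sn by (simp add: mult_monom)
  finally have "?p n (P * Q) = monom 1 (n - s) * ?p s (Q * P)"
    by (simp add: mult.assoc monom_eq_0_iff)
  then have "coeff (?p n (P * Q)) (n - s) = poly (?p s (Q * P)) 0"
    by (simp add: coeff_monom_mult poly_0_coeff_0)
  also have "\<dots> = det (Q * P)" 
  proof -
    have "0 \<cdot>\<^sub>m 1\<^sub>m s + Q * P = Q * P" using P Q by (intro eq_matI) auto
    then show ?thesis by (simp only: p[OF QP])
  qed
  also have "coeff (?p n (P * Q)) (n - s) =
      (\<Sum>\<beta>\<in>Pow {0..<n}. if card \<beta> = s then principal_minor (P * Q) \<beta> else 0)"
  proof -
    \<comment> \<open>Natural subtraction truncates, but both sizes are at most \<open>n\<close>, so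
      the exponent determines the size of \<beta>.\<close>
    have "n - card \<beta> = n - s \<longleftrightarrow> card \<beta> = s" if "\<beta> \<in> Pow {0..<n}" for \<beta>
      using card_mono[of "{0..<n}" \<beta>] that sn by auto
    then show ?thesis unfolding coeff_sum by (intro sum.cong refl) simp
  qed
  also have "\<dots> = (\<Sum>\<beta>\<in>ksubsets s n. principal_minor (P * Q) \<beta>)"
    by (simp add: sum.If_cases ksubsets_def Int_def)
  finally show ?thesis by simp
qed

text \<open>The matrix determinant lemma: \<open>G + U V = G (I + H U V)\<close>, and swapping the
  factors \<open>H U\<close> and \<open>V\<close> at \<open>x = 1\<close> reduces the second
  determinant to size one.\<close>

lemma det_rank_one_update:
  fixes G :: "'a :: idom mat"
  assumes G: "G \<in> carrier_mat s s" and H: "H \<in> carrier_mat s s" and GH: "G * H = 1\<^sub>m s"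
    and U: "U \<in> carrier_mat s 1" and V: "V \<in> carrier_mat 1 s"
  shows "det (G + U * V) = det G * (1 + (V * (H * U)) $$ (0, 0))"
proof -
  have HU: "H * U \<in> carrier_mat s 1" using H U by auto
  have one: "1 \<cdot>\<^sub>m 1\<^sub>m s = (1\<^sub>m s :: 'a mat)" by (intro eq_matI) auto
  have "G * (1\<^sub>m s + H * U * V) = G * 1\<^sub>m s + G * (H * U * V)"
    using G H U V by (intro mult_add_distrib_mat) auto
  also have "G * (H * U * V) = G * H * (U * V)"
    by (subst assoc_mult_mat[OF H U V], subst assoc_mult_mat[OF G H]) (use U V in auto)
  also have "G * 1\<^sub>m s + \<dots> = G + U * V" using G U V by (simp add: GH)
  finally have "det (G + U * V) = det (G * (1 \<cdot>\<^sub>m 1\<^sub>m s + H * U * V))" by (simp add: one)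
  also have "\<dots> = det G * det (1 \<cdot>\<^sub>m 1\<^sub>m s + H * U * V)"
    by (rule det_mult[OF G]) (use H U V in auto)
  also have "det (1 \<cdot>\<^sub>m 1\<^sub>m s + H * U * V) = det (1 \<cdot>\<^sub>m 1\<^sub>m 1 + V * (H * U))"
    using det_scalar_plus_mult_commute[OF HU V, of 1] by simp
  also have "\<dots> = 1 + (V * (H * U)) $$ (0, 0)"
    using V HU by (subst det_single) auto
  finally show ?thesis .
qed

text \<open>The Leibniz sum over permutations of \<beta> sees no other entries. Hence a minor
  avoiding \<open>i\<close> ignores whatever replaces column \<open>i\<close>.\<close>

lemma principal_minor_cong:
  fixes M N :: "'a :: comm_ring_1 mat"
  assumes "M \<in> carrier_mat n n" "N \<in> carrier_mat n n" "\<beta> \<subseteq> {0..<n}"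
    and "\<And>i j. i \<in> \<beta> \<Longrightarrow> j \<in> \<beta> \<Longrightarrow> M $$ (i, j) = N $$ (i, j)"
  shows "principal_minor M \<beta> = principal_minor N \<beta>"
  unfolding principal_minor_leibniz[OF assms(1,3)] principal_minor_leibniz[OF assms(2,3)]
  by (intro sum.cong prod.cong arg_cong[where f = "\<lambda>x. _ * x"] refl assms(4))
    (auto simp: permutes_in_image)

text \<open>Every permutation of \<beta> attains the value \<open>j\<close>, so each Leibniz term
  has a factor from the zero column.\<close>

lemma principal_minor_zero_col:
  fixes M :: "'a :: comm_ring_1 mat"
  assumes M: "M \<in> carrier_mat n n" and b: "\<beta> \<subseteq> {0..<n}" and j: "j \<in> \<beta>"
    and z: "\<And>i. i \<in> \<beta> \<Longrightarrow> M $$ (i, j) = 0"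
  shows "principal_minor M \<beta> = 0"
  unfolding principal_minor_leibniz[OF M b]
proof (intro sum.neutral ballI)
  fix p assume "p \<in> {p. p permutes \<beta>}"
  then have p: "p permutes \<beta>" by simp
  then obtain i where "i \<in> \<beta>" "p i = j" using j permutes_image[OF p] by (metis imageE)
  moreover have "finite \<beta>" using b by (rule finite_subset) simp
  ultimately have "(\<Prod>i\<in>\<beta>. M $$ (i, p i)) = 0" using z by (intro prod_zero) auto
  then show "signof p * (\<Prod>i\<in>\<beta>. M $$ (i, p i)) = 0" by simp
qed

lemma principal_minor_transpose:
  fixes M :: "'a :: comm_ring_1 mat"
  assumes "M \<in> carrier_mat n n"
  shows "principal_minor (transpose_mat M) \<beta> = principal_minor M \<beta>"
proof -
  have "submatrix (transpose_mat M) \<beta> \<beta> = transpose_mat (submatrix M \<beta> \<beta>)"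
    using assms by (intro eq_matI) (auto simp: submatrix_def intro!: index_transpose_mat(1) pick_le)
  moreover have "submatrix M \<beta> \<beta> \<in> carrier_mat (card {i. i < n \<and> i \<in> \<beta>}) (card {i. i < n \<and> i \<in> \<beta>})"
    using assms by (auto simp: submatrix_def)
  ultimately show ?thesis by (simp add: principal_minor_def det_transpose)
qed

lemma finite_ksubsets [simp]: "finite (ksubsets k n)"
  unfolding ksubsets_def by (rule finite_subset[of _ "Pow {0..<n}"]) auto

section \<open>A Cramer rule for singular matrices\<close>

text \<open>The principal minors avoiding \<open>i\<close> do not depend on \<open>y\<close>, and those through \<open>i\<close> vanish at \<open>y = 0\<close>;
  hence the sum is the difference of the totals at \<open>y\<close> and at \<open>0\<close>.\<close>

lemma sum_principal_minors_replace_col_mult_vec: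
  fixes P Q :: "'a :: {idom, ring_char_0} mat"
  assumes P: "P \<in> carrier_mat n s" and Q: "Q \<in> carrier_mat s n" and sn: "s \<le> n"
    and H: "H \<in> carrier_mat s s" and inv: "Q * P * H = 1\<^sub>m s"
    and y: "y \<in> carrier_vec n" and i: "i < n"
  shows "(\<Sum>\<beta>\<in>ksubsets_containing s n i. principal_minor (replace_col (P * Q) (P * Q *\<^sub>v y) i) \<beta>)
    = det (Q * P) * (P * H * Q *\<^sub>v y) $ i"
proof -
  let ?M = "P * Q" and ?K = "P * H * Q"
  let ?N = "\<lambda>y. replace_col ?M (?M *\<^sub>v y) i"
  let ?S = "\<lambda>y. \<Sum>\<beta>\<in>ksubsets_containing s n i. principal_minor (?N y) \<beta>"
  let ?T = "\<lambda>y. \<Sum>\<beta>\<in>ksubsets s n - ksubsets_containing s n i. principal_minor (?N y) \<beta>"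
  have M: "?M \<in> carrier_mat n n" and K: "?K \<in> carrier_mat n n" using P Q H by auto
  have N: "?N y \<in> carrier_mat n n" for y using P Q by (auto simp: replace_col_def)
  have total: "?S y + ?T y = det (Q * P) * (1 + (?K *\<^sub>v y) $ i - ?K $$ (i, i))"
    if y: "y \<in> carrier_vec n" for y
  proof -
    \<comment> \<open>\<open>C\<close> is the column \<open>y - e_i\<close> and \<open>R\<close> the
      row \<open>e_i\<close>. Adding \<open>?M * C * R\<close> thus changes only column
      \<open>i\<close> of \<open>?M\<close>, from \<open>?M e_i\<close> to
      \<open>?M y\<close>.\<close>
    define C where "C = mat n 1 (\<lambda>(k, l). y $ k - (if k = i then 1 else 0))"
    define R :: "'a mat" where "R = mat 1 n (\<lambda>(k, l). if l = i then 1 else 0)"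
    have C: "C \<in> carrier_mat n 1" and R: "R \<in> carrier_mat 1 n" by (auto simp: C_def R_def)
    have sc: "(X * C) $$ (k, 0) = (X *\<^sub>v y) $ k - X $$ (k, i)"
      if "X \<in> carrier_mat n n" "k < n" for X k
      using that y i
      by (simp add: C_def scalar_prod_def right_diff_distrib sum_subtractf if_distrib[where f = "(*) _"]
        cong: if_cong)
    have "?N y = ?M + ?M * C * R"
    proof (rule eq_matI)
      fix k l assume "k < dim_row (?M + ?M * C * R)" "l < dim_col (?M + ?M * C * R)"
      then have k: "k < n" and l: "l < n" using P R by auto
      have "(?M * C * R) $$ (k, l) = (?M * C) $$ (k, 0) * R $$ (0, l)"
        using k l P Q C R by (simp add: scalar_prod_def del: assoc_mult_mat)
      then have "(?M * C * R) $$ (k, l) = (if l = i then (?M *\<^sub>v y) $ k - ?M $$ (k, i) else 0)"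
        using k l sc[OF M k] by (simp add: R_def)
      then show "?N y $$ (k, l) = (?M + ?M * C * R) $$ (k, l)"
        using k l P Q C R by (auto simp: replace_col_def)
    qed (use P Q C R in \<open>auto simp: replace_col_def\<close>)
    \<comment> \<open>With \<open>P\<close> pulled out, the perturbed matrix is still a product of
      inner dimension \<open>s\<close>, so its principal \<open>s\<close>-minors sum up to an
      \<open>s\<close> by \<open>s\<close> determinant.\<close>
    also have "\<dots> = P * (Q + Q * C * R)"
      using P Q C R by (simp add: mult_add_distrib_mat[of _ n s] assoc_mult_mat[of _ n s _ n _ 1]
          assoc_mult_mat[of _ n s _ 1 _ n] assoc_mult_mat[of _ n s _ n _ n])
    finally have "?S y + ?T y = (\<Sum>\<beta>\<in>ksubsets s n. principal_minor (P * (Q + Q * C * R)) \<beta>)"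
      using sum.subset_diff[of "ksubsets_containing s n i" "ksubsets s n" "\<lambda>\<beta>. principal_minor (?N y) \<beta>"]
      by (simp add: ksubsets_containing_def add.commute)
    also have "\<dots> = det ((Q + Q * C * R) * P)"
      using P Q C R sn by (intro sum_principal_minors_mult) auto
    also have "(Q + Q * C * R) * P = Q * P + Q * C * R * P"
      using P Q C R by (intro add_mult_distrib_mat) auto
    also have "Q * C * R * P = Q * C * (R * P)"
      using P Q C R by (intro assoc_mult_mat) auto
    also have "det (Q * P + Q * C * (R * P)) = det (Q * P) * (1 + (R * P * (H * (Q * C))) $$ (0, 0))"
      using P Q C R H inv by (intro det_rank_one_update) auto
    \<comment> \<open>Regrouped in this way, \<open>R\<close> reads off entry \<open>i\<close> of
      \<open>?K (y - e_i)\<close>.\<close>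
    also have "R * P * (H * (Q * C)) = R * (?K * C)"
      using P Q C R H by (simp add: assoc_mult_mat[of _ 1 n _ s _ 1] assoc_mult_mat[of _ n s _ s _ n]
        assoc_mult_mat[of _ n s _ n _ 1] assoc_mult_mat[of _ s s _ n _ 1])
    also have "(R * (?K * C)) $$ (0, 0) = (?K * C) $$ (i, 0)"
    proof -
      have "row R 0 = unit_vec n i" using i by (auto simp: R_def unit_vec_def)
      moreover have "col (?K * C) 0 \<in> carrier_vec n" using P by (intro carrier_vecI) simp
      ultimately show ?thesis
        using R C P i by (simp add: scalar_prod_left_unit[of _ n] del: assoc_mult_mat)
    qed
    also have "\<dots> = (?K *\<^sub>v y) $ i - ?K $$ (i, i)" by (rule sc[OF K i])
    finally show ?thesis by (simp add: add_diff_eq)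
  qed
  have "?T y = ?T (0\<^sub>v n)"
    by (intro sum.cong refl principal_minor_cong[OF N N])
      (use P Q M in \<open>auto simp: subset_eq ksubsets_def ksubsets_containing_def replace_col_def\<close>)
  moreover have "?M *\<^sub>v 0\<^sub>v n = 0\<^sub>v n" by (rule mult_mat_zero_vec[OF M])
  then have "?S (0\<^sub>v n) = 0"
    by (intro sum.neutral ballI principal_minor_zero_col[OF N, of _ i])
      (use P Q in \<open>auto simp: subset_eq ksubsets_def ksubsets_containing_def replace_col_def\<close>)
  moreover have "(?K *\<^sub>v 0\<^sub>v n) $ i = 0" using mult_mat_zero_vec[OF K] i by simp
  ultimately have "?S y = det (Q * P) * (1 + (?K *\<^sub>v y) $ i - ?K $$ (i, i))
      - det (Q * P) * (1 - ?K $$ (i, i))"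
    using total[OF y] total[of "0\<^sub>v n"] by (simp add: eq_diff_eq)
  then show ?thesis by (simp add: algebra_simps)
qed

text \<open>Column \<open>f\<close> of \<open>P Q W\<close> is \<open>P Q\<close> applied to column
  \<open>f\<close> of \<open>W\<close>, which serves as the vector \<open>y\<close>.\<close>

lemma sum_principal_minors_replace_col:
  fixes P Q :: "'a :: {idom, ring_char_0} mat"
  assumes P: "P \<in> carrier_mat n s" and Q: "Q \<in> carrier_mat s n" and sn: "s \<le> n"
    and H: "H \<in> carrier_mat s s" and inv: "Q * P * H = 1\<^sub>m s"
    and W: "W \<in> carrier_mat n m" and i: "i < n" and f: "f < m"
  shows "(\<Sum>\<beta>\<in>ksubsets_containing s n i. principal_minor (replace_col (P * Q) (col (P * Q * W) f) i) \<beta>)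
    = det (Q * P) * (P * H * Q * W) $$ (i, f)"
proof -
  have "col (P * Q * W) f = P * Q *\<^sub>v col W f"
    using P Q W f by (intro col_mult2[of _ n n]) auto
  moreover have "(P * H * Q * W) $$ (i, f) = (P * H * Q *\<^sub>v col W f) $ i"
    using P Q H W i f by simp
  ultimately show ?thesis
    using sum_principal_minors_replace_col_mult_vec[OF P Q sn H inv, of "col W f" i] W i by auto
qed

text \<open>Transposition reduces this to the column rule for the factors \<open>?t Q\<close> and
  \<open>?t P\<close>, whose \<open>s\<close> by \<open>s\<close> product \<open>?t P * ?t Q\<close>
  is the transpose of \<open>Q P\<close>.\<close>

lemma sum_principal_minors_replace_row:
  fixes P Q :: "'a :: {field, ring_char_0} mat"
  assumes P: "P \<in> carrier_mat n s" and Q: "Q \<in> carrier_mat s n" and sn: "s \<le> n"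
    and H: "H \<in> carrier_mat s s" and inv: "Q * P * H = 1\<^sub>m s"
    and W: "W \<in> carrier_mat m n" and j: "j < n" and l: "l < m"
  shows "(\<Sum>\<alpha>\<in>ksubsets_containing s n j. principal_minor (replace_row (P * Q) (row (W * (P * Q)) l) j) \<alpha>)
    = det (Q * P) * (W * (P * H * Q)) $$ (l, j)"
proof -
  let ?t = transpose_mat
  have QP: "Q * P \<in> carrier_mat s s" using P Q by auto
  have t: "?t Q \<in> carrier_mat n s" "?t P \<in> carrier_mat s n" "?t H \<in> carrier_mat s s"
    "?t W \<in> carrier_mat n m" using P Q H W by auto
  \<comment> \<open>Transposition swaps left and right inverses, so \<open>H\<close> is first made a
    left inverse.\<close>
  have "H * (Q * P) = 1\<^sub>m s" by (rule mat_mult_left_right_inverse[OF QP H inv])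
  then have "?t (H * (Q * P)) = 1\<^sub>m s" by simp
  then have inv': "?t P * ?t Q * ?t H = 1\<^sub>m s"
    using H P Q QP by (simp add: transpose_mult[of _ s s _ s] transpose_mult[of _ s n _ s])
  have QPt: "?t Q * ?t P = ?t (P * Q)" using P Q by (simp add: transpose_mult)
  have "principal_minor (replace_row (P * Q) (row (W * (P * Q)) l) j) \<alpha>
      = principal_minor (replace_col (?t Q * ?t P) (col (?t Q * ?t P * ?t W) l) j) \<alpha>" for \<alpha>
  proof -
    have "?t Q * ?t P * ?t W = ?t (W * (P * Q))"
      using P Q W by (simp add: QPt transpose_mult[of _ m n _ n])
    then have "col (?t Q * ?t P * ?t W) l = row (W * (P * Q)) l" using W l by simp
    then have "replace_col (?t Q * ?t P) (col (?t Q * ?t P * ?t W) l) j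
        = ?t (replace_row (P * Q) (row (W * (P * Q)) l) j)"
      using P Q by (intro eq_matI) (auto simp: QPt replace_col_def replace_row_def)
    moreover have "replace_row (P * Q) (row (W * (P * Q)) l) j \<in> carrier_mat n n"
      using P Q by (auto simp: replace_row_def)
    ultimately show ?thesis by (simp add: principal_minor_transpose)
  qed
  then have "(\<Sum>\<alpha>\<in>ksubsets_containing s n j. principal_minor (replace_row (P * Q) (row (W * (P * Q)) l) j) \<alpha>)
    = det (?t P * ?t Q) * (?t Q * ?t H * ?t P * ?t W) $$ (j, l)"
    by (simp add: sum_principal_minors_replace_col[OF t(1,2) sn t(3) inv' t(4) j l])
  moreover have "det (?t P * ?t Q) = det (Q * P)"
    using P Q by (simp add: transpose_mult[symmetric] det_transpose[OF QP])
  moreover have "?t Q * ?t H * ?t P * ?t W = ?t (W * (P * H * Q))"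
    using P Q H W by (simp add: transpose_mult[of _ m n _ n] transpose_mult[of _ n s _ n]
       transpose_mult[of _ s s _ n])
  ultimately show ?thesis using W Q j l by simp
qed

text \<open>The column rule for \<open>M\<close> turns the left factor \<open>M\<close> of
  \<open>T = M Z N\<close> into \<open>P H Q\<close>, and the row rule for \<open>N\<close> turns
  the right factor into \<open>P' H' Q'\<close>; each costs a determinant, which the denominator
  removes. The two formulas apply the rules in opposite orders.\<close>

lemma double_cramer:
  fixes P Q :: "'a :: {field, ring_char_0} mat"
  assumes P: "P \<in> carrier_mat n s" and Q: "Q \<in> carrier_mat s n" and sn: "s \<le> n"
    and H: "H \<in> carrier_mat s s" and inv: "Q * P * H = 1\<^sub>m s"
    and P': "P' \<in> carrier_mat n s" and Q': "Q' \<in> carrier_mat s n"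
    and H': "H' \<in> carrier_mat s s" and inv': "Q' * P' * H' = 1\<^sub>m s"
    and Z: "Z \<in> carrier_mat n n" and M: "M = P * Q" and N: "N = P' * Q'" and T: "T = M * Z * N"
    and X: "X = P * H * Q * Z * (P' * H' * Q')"
    and i: "i < n" and j: "j < n"
  shows "X $$ (i, j) =
      (\<Sum>\<alpha>\<in>ksubsets_containing s n j. principal_minor (replace_row N (vec n (\<lambda>f.
        \<Sum>\<beta>\<in>ksubsets_containing s n i. principal_minor (replace_col M (col T f) i) \<beta>)) j) \<alpha>)
      / ((\<Sum>\<alpha>\<in>ksubsets s n. principal_minor N \<alpha>) * (\<Sum>\<beta>\<in>ksubsets s n. principal_minor M \<beta>))" (is "_ = ?r")
    and "X $$ (i, j) =
      (\<Sum>\<beta>\<in>ksubsets_containing s n i. principal_minor (replace_col M (vec n (\<lambda>l.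
        \<Sum>\<alpha>\<in>ksubsets_containing s n j. principal_minor (replace_row N (row T l) j) \<alpha>)) i) \<beta>)
      / ((\<Sum>\<alpha>\<in>ksubsets s n. principal_minor N \<alpha>) * (\<Sum>\<beta>\<in>ksubsets s n. principal_minor M \<beta>))" (is "_ = ?c")
proof -
  let ?K = "P * H * Q" and ?K' = "P' * H' * Q'"
  let ?d = "det (Q * P)" and ?d' = "det (Q' * P')"
  have nz: "?d \<noteq> 0" "?d' \<noteq> 0"
    using det_mult[of "Q * P" s H] det_mult[of "Q' * P'" s H'] P Q H P' Q' H' inv inv' by auto
  have sums: "(\<Sum>\<beta>\<in>ksubsets s n. principal_minor M \<beta>) = ?d"
    "(\<Sum>\<alpha>\<in>ksubsets s n. principal_minor N \<alpha>) = ?d'"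
    using sum_principal_minors_mult[OF P Q sn] sum_principal_minors_mult[OF P' Q' sn] M N by auto
  have K: "?K \<in> carrier_mat n n" "?K' \<in> carrier_mat n n" and MN: "M \<in> carrier_mat n n" "N \<in> carrier_mat n n"
    using P Q H P' Q' H' M N by auto
  \<comment> \<open>The inner sums form row \<open>i\<close> of a matrix multiplied by
    \<open>N\<close> from the right, which is the shape that the row rule accepts.\<close>
  have "(vec n (\<lambda>f. \<Sum>\<beta>\<in>ksubsets_containing s n i. principal_minor (replace_col M (col T f) i) \<beta>))
      = row (?d \<cdot>\<^sub>m (?K * Z) * (P' * Q')) i"
  proof (rule eq_vecI)
    fix f assume "f < dim_vec (row (?d \<cdot>\<^sub>m (?K * Z) * (P' * Q')) i)"
    then have f: "f < n" using Q' by simp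
    have "T = P * Q * (Z * N)"
      unfolding T using assoc_mult_mat[OF MN(1) Z MN(2)] by (simp add: M)
    then show "vec n (\<lambda>f. \<Sum>\<beta>\<in>ksubsets_containing s n i. principal_minor (replace_col M (col T f) i) \<beta>) $ f
      = row (?d \<cdot>\<^sub>m (?K * Z) * (P' * Q')) i $ f"
      using sum_principal_minors_replace_col[OF P Q sn H inv, of "Z * N" n i f] K MN Z i f M N
      using P Q' by (simp add: mult_smult_assoc_mat[of _ n n _ n])
  qed (use Q' in simp)
  then have "?r = (?d' * (?d \<cdot>\<^sub>m (?K * Z) * ?K') $$ (i, j)) / (?d' * ?d)"
    using sum_principal_minors_replace_row[OF P' Q' sn H' inv', of "?d \<cdot>\<^sub>m (?K * Z)" n j i] K Z i j N
    by (simp add: sums sums(2)[unfolded N])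
  then show "X $$ (i, j) = ?r"
    using P Q' K Z i j nz by (simp add: X mult_smult_assoc_mat[of _ n n _ n])
  \<comment> \<open>Symmetrically, the inner sums form column \<open>j\<close> of \<open>M\<close>
    times a matrix, ready for the column rule.\<close>
  have "(vec n (\<lambda>l. \<Sum>\<alpha>\<in>ksubsets_containing s n j. principal_minor (replace_row N (row T l) j) \<alpha>))
      = col (P * Q * (?d' \<cdot>\<^sub>m (Z * ?K'))) j"
  proof (rule eq_vecI)
    fix l assume "l < dim_vec (col (P * Q * (?d' \<cdot>\<^sub>m (Z * ?K'))) j)"
    then have l: "l < n" using P by simp
    have "T = (M * Z) * (P' * Q')" unfolding T N ..
    then show "vec n (\<lambda>l. \<Sum>\<alpha>\<in>ksubsets_containing s n j. principal_minor (replace_row N (row T l) j) \<alpha>) $ l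
      = col (P * Q * (?d' \<cdot>\<^sub>m (Z * ?K'))) j $ l"
      using sum_principal_minors_replace_row[OF P' Q' sn H' inv', of "M * Z" n j l] K MN Z j l M N
      using P Q' by (simp add: mult_smult_distrib[of _ n n _ n] del: index_mult_mat(1))
  qed (use P in simp)
  then have "?c = (?d * (?K * (?d' \<cdot>\<^sub>m (Z * ?K'))) $$ (i, j)) / (?d' * ?d)"
    using sum_principal_minors_replace_col[OF P Q sn H inv, of "?d' \<cdot>\<^sub>m (Z * ?K')" n i j] K Z i j M
    by (simp add: sums sums(1)[unfolded M])
  then show "X $$ (i, j) = ?c"
    using P Q' K Z i j nz by (simp add: X mult_smult_distrib[of _ n n _ n])
qed

section \<open>Rank factorization\<close>

lemma inj_square_mat_inverse:
  fixes G :: "'a :: field mat"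
  assumes G: "G \<in> carrier_mat s s"
    and inj: "\<And>v. v \<in> carrier_vec s \<Longrightarrow> G *\<^sub>v v = 0\<^sub>v s \<Longrightarrow> v = 0\<^sub>v s"
  obtains H where "H \<in> carrier_mat s s" "G * H = 1\<^sub>m s" "H * G = 1\<^sub>m s"
proof -
  have "det G \<noteq> 0" using det_0_iff_vec_prod_zero[OF G] inj by auto
  from det_non_zero_imp_unit[OF G this, of "()"] obtain H
    where "H \<in> carrier_mat s s" "H * G = 1\<^sub>m s" "G * H = 1\<^sub>m s"
    by (auto simp: Units_def ring_mat_def)
  then show ?thesis using that by simp
qed

text \<open>The columns of \<open>P\<close> are a maximal independent set of columns of
  \<open>A\<close>, and \<open>Q\<close> holds the coordinates of all columns in this basis. The
  basis vectors being columns of \<open>A\<close> themselves, \<open>Q\<close> contains all unit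
  vectors as columns, and \<open>R\<close> selects them.\<close>

lemma rank_factorization:
  fixes A :: "'a :: field mat"
  assumes A: "A \<in> carrier_mat n m" and rk: "vec_space.rank n A = s"
  obtains P Q R where "P \<in> carrier_mat n s" "Q \<in> carrier_mat s m" "R \<in> carrier_mat m s"
    "A = P * Q" "Q * R = 1\<^sub>m s" "\<And>v. v \<in> carrier_vec s \<Longrightarrow> P *\<^sub>v v = 0\<^sub>v n \<Longrightarrow> v = 0\<^sub>v s"
proof -
  interpret vec_space "TYPE('a)" n .
  let ?C = "set (cols A)"
  have C: "?C \<subseteq> carrier_vec n" using A cols_dim by blast
  obtain S where S: "maximal S (\<lambda>T. T \<subseteq> ?C \<and> lin_indpt T)"
    using maximal_exists[of "\<lambda>T. T \<subseteq> ?C \<and> lin_indpt T" "card ?C" "{}"]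
    by (meson List.finite_set card_mono empty_iff empty_subsetI finite_lin_indpt2 rev_finite_subset)
  have SC: "S \<subseteq> ?C" and ind: "lin_indpt S" using S by (auto simp: maximal_def)
  have Sn: "S \<subseteq> carrier_vec n" using SC C by blast
  have fin: "finite S" using SC finite_subset by blast
  have cS: "card S = s" using rank_card_indpt[OF A S] rk by simp
  obtain bs where bs: "set bs = S" "distinct bs" using finite_distinct_list[OF fin] by blast
  have len: "length bs = s" using bs cS distinct_card by metis
  define P where "P = mat_of_cols n bs"
  have P: "P \<in> carrier_mat n s" using len by (auto simp: P_def)
  have cP: "cols P = bs" using bs Sn by (simp add: P_def)
  have inj: "v = 0\<^sub>v s" if "v \<in> carrier_vec s" "P *\<^sub>v v = 0\<^sub>v n" for v
    using lin_depI[OF P that(1) _ that(2)] ind unfolding cP bs(1) using bs(2) by argo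
  have "\<exists>x \<in> carrier_vec s. col A j = P *\<^sub>v x" if j: "j < m" for j
  proof -
    have cA: "col A j \<in> ?C" using A j by (auto simp: cols_def)
    \<comment> \<open>By maximality, a column outside \<open>S\<close> makes \<open>S\<close>
      dependent when added, so it lies in the span.\<close>
    have "col A j \<in> span S"
    proof (cases "col A j \<in> S")
      case True
      then show ?thesis using Sn span_mem by auto
    next
      case False
      then have "lin_dep (S \<union> {col A j})" using S cA SC unfolding maximal_def by blast
      then show ?thesis using lin_dep_iff_in_span[OF _ ind _ False] Sn cA C by auto
    qed
    then have "\<exists>a. col A j = lincomb a S" using finite_in_span[OF fin Sn, of "col A j"] by metis
    then obtain a where "col A j = lincomb a S" ..
    also have "\<dots> = P *\<^sub>v vec s (\<lambda>i. a (col P i))"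
      using mat_mult_eq_lincomb[OF P, of a] by (simp add: cP bs)
    finally show ?thesis by (rule bexI) simp
  qed
  then obtain x where x: "\<And>j. j < m \<Longrightarrow> x j \<in> carrier_vec s" "\<And>j. j < m \<Longrightarrow> col A j = P *\<^sub>v x j"
    using bchoice[of "{..<m}" "\<lambda>j x. x \<in> carrier_vec s \<and> col A j = P *\<^sub>v x"]
    by (metis lessThan_iff)
  define Q where "Q = mat s m (\<lambda>(k, j). x j $ k)"
  have Q: "Q \<in> carrier_mat s m" by (simp add: Q_def)
  have colQ: "col Q j = x j" if "j < m" for j using x(1)[OF that] that by (auto simp: Q_def)
  have APQ: "A = P * Q"
    by (rule mat_col_eqI) (use A P Q colQ x(2) in auto)
  have "\<exists>j<m. bs ! k = col A j" if k: "k < s" for k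
  proof -
    have "bs ! k \<in> ?C" using k len bs SC nth_mem by blast
    then show ?thesis using A by (auto simp: cols_def)
  qed
  then obtain c where c: "\<And>k. k < s \<Longrightarrow> c k < m" "\<And>k. k < s \<Longrightarrow> bs ! k = col A (c k)" by metis
  \<comment> \<open>\<open>c k\<close> is a position in \<open>A\<close> of the \<open>k\<close>-th
    basis column, so \<open>Q * R\<close> lists columns \<open>c k\<close> of
    \<open>Q\<close>.\<close>
  define R where "R = mat m s (\<lambda>(l, k). if l = c k then 1 else (0::'a))"
  have R: "R \<in> carrier_mat m s" by (simp add: R_def)
  have "Q * R = 1\<^sub>m s"
  proof (rule mat_col_eqI)
    fix k assume "k < dim_col (1\<^sub>m s :: 'a mat)"
    then have k: "k < s" by simp
    have "col R k = unit_vec m (c k)" using k by (auto simp: R_def unit_vec_def)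
    then have QRk: "col (Q * R) k = col Q (c k)"
      using mult_mat_unit_vec[OF Q c(1)[OF k]] by (simp only: col_mult2[OF Q R k])
    have "bs ! k \<in> carrier_vec n" using k len bs Sn nth_mem by blast
    then have "col P k = bs ! k" using k len by (simp add: P_def)
    \<comment> \<open>Both \<open>x (c k)\<close> and the unit vector are coordinates of the same
      column; injectivity of \<open>P\<close> identifies them.\<close>
    then have "P *\<^sub>v x (c k) = P *\<^sub>v unit_vec s k"
      using x(2)[OF c(1)[OF k]] c(2)[OF k] k by (simp add: mult_mat_unit_vec[OF P])
    then have "P *\<^sub>v (x (c k) - unit_vec s k) = 0\<^sub>v n"
      using x(1)[OF c(1)[OF k]] P k by (simp add: mult_minus_distrib_mat_vec[of _ n s])
    then have "x (c k) - unit_vec s k = 0\<^sub>v s"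
      using x(1)[OF c(1)[OF k]] by (intro inj) auto
    then have eq0: "(x (c k) - unit_vec s k) $ i = 0" if "i < s" for i using that by simp
    have "x (c k) = unit_vec s k"
    proof (rule eq_vecI)
      fix i assume "i < dim_vec (unit_vec s k :: 'a vec)"
      then have "i < s" by simp
      then show "x (c k) $ i = unit_vec s k $ i"
        using eq0[of i] x(1)[OF c(1)[OF k]] k by (simp del: index_unit_vec(1,2))
    qed (use x(1)[OF c(1)[OF k]] in auto)
    then show "col (Q * R) k = col (1\<^sub>m s) k"
      using QRk colQ c(1) k by simp
  qed (use Q R in auto)
  then show thesis using that[OF P Q R APQ _ inj] by blast
qed

section \<open>Conjugate transposes and kernels\<close>

lemma mat_adjoint_carrier:
  "A \<in> carrier_mat n m \<Longrightarrow> mat_adjoint A \<in> carrier_mat m n"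
  by (auto simp: mat_adjoint_def)

lemma mat_adjoint_dim [simp]:
  "dim_row (mat_adjoint A) = dim_col A" "dim_col (mat_adjoint A) = dim_row A"
  by (auto simp: mat_adjoint_def)

lemma mat_adjoint_eq_transpose: "mat_adjoint A = transpose_mat (map_mat conjugate A)"
  by (intro eq_matI) (auto simp: mat_adjoint_def mat_of_rows_def)

lemma mat_adjoint_mult:
  fixes A B :: "complex mat"
  assumes "dim_col A = dim_row B"
  shows "mat_adjoint (A * B) = mat_adjoint B * mat_adjoint A"
  using assms
  by (intro eq_matI) (auto simp: mat_adjoint_eq_transpose scalar_prod_def mult.commute)

lemma mat_adjoint_adjoint [simp]: "mat_adjoint (mat_adjoint A) = (A :: complex mat)"
  by (intro eq_matI) (auto simp: mat_adjoint_eq_transpose)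

lemma mat_adjoint_one [simp]: "mat_adjoint (1\<^sub>m n) = (1\<^sub>m n :: complex mat)"
  by (intro eq_matI) (auto simp: mat_adjoint_eq_transpose)

text \<open>The squared norm of \<open>P v\<close> is the scalar product of
  \<open>mat_adjoint P * P *\<^sub>v v\<close> with \<open>v\<close>, hence 0. This yields
  invertible Gram matrices.\<close>

lemma adjoint_mult_self_inj:
  fixes P :: "complex mat"
  assumes P: "P \<in> carrier_mat n s" and v: "v \<in> carrier_vec s"
    and z: "mat_adjoint P * P *\<^sub>v v = 0\<^sub>v s"
  shows "P *\<^sub>v v = 0\<^sub>v n"
proof -
  let ?w = "P *\<^sub>v v"
  have w: "?w \<in> carrier_vec n" using P v by simp
  \<comment> \<open>Conjugating moves the hypothesis to the plain transpose, which can be shifted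
    across the bilinear scalar product.\<close>
  have "transpose_mat P *\<^sub>v conjugate ?w = conjugate (mat_adjoint P *\<^sub>v ?w)"
    using P v by (intro eq_vecI) (auto simp: mat_adjoint_eq_transpose scalar_prod_def)
  also have "mat_adjoint P *\<^sub>v ?w = 0\<^sub>v s" using z P v mat_adjoint_carrier[OF P] by simp
  finally have "(transpose_mat P *\<^sub>v conjugate ?w) \<bullet> v = 0" using v by simp
  then have "conjugate ?w \<bullet> ?w = 0" using transpose_vec_mult_scalar[OF P v, of "conjugate ?w"] w by simp
  then have "?w \<bullet>c ?w = 0" using w by (metis carrier_vec_conjugate comm_scalar_prod)
  then show ?thesis using conjugate_square_eq_0_vec[OF w] by simp
qed

text \<open>The adjoint of \<open>R\<close> is a left inverse of the adjoint of
  \<open>Q\<close>.\<close>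

lemma right_inverse_adjoint_inj:
  fixes Q :: "complex mat"
  assumes Q: "Q \<in> carrier_mat s m" and R: "R \<in> carrier_mat m s" and QR: "Q * R = 1\<^sub>m s"
    and v: "v \<in> carrier_vec s" and z: "mat_adjoint Q *\<^sub>v v = 0\<^sub>v m"
  shows "v = 0\<^sub>v s"
proof -
  have c: "mat_adjoint Q \<in> carrier_mat m s" "mat_adjoint R \<in> carrier_mat s m"
    using Q R by (auto intro: mat_adjoint_carrier)
  have "mat_adjoint R * mat_adjoint Q = 1\<^sub>m s"
    using mat_adjoint_mult[of Q R] Q R QR by simp
  then have "v = mat_adjoint R * mat_adjoint Q *\<^sub>v v" using v by simp
  also have "\<dots> = 0\<^sub>v s"
    using assoc_mult_mat_vec[OF c(2,1) v] z mult_mat_zero_vec[OF c(2)] by simp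
  finally show ?thesis .
qed

section \<open>Moore--Penrose and core inverses\<close>

text \<open>Write \<open>A X\<close> as \<open>A Y A X\<close> and take adjoints: the two
  self-adjoint factors swap, giving \<open>A X A Y = A Y\<close>. Likewise \<open>X A = Y A\<close>,
  so \<open>X = X A X = X A Y = Y A Y = Y\<close>.\<close>

lemma is_mp_inverse_unique:
  assumes "is_mp_inverse A X" "is_mp_inverse A Y"
  shows "X = Y"
proof -
  let ?n = "dim_row A" and ?m = "dim_col A"
  have A: "A \<in> carrier_mat ?n ?m" by simp
  have X: "X \<in> carrier_mat ?m ?n" "A * X * A = A" "X * A * X = X"
      "mat_adjoint (A * X) = A * X" "mat_adjoint (X * A) = X * A"
    and Y: "Y \<in> carrier_mat ?m ?n" "A * Y * A = A" "Y * A * Y = Y"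
      "mat_adjoint (A * Y) = A * Y" "mat_adjoint (Y * A) = Y * A"
    using assms by (auto simp: is_mp_inverse_def)
  have AX: "A * X \<in> carrier_mat ?n ?n" and AY: "A * Y \<in> carrier_mat ?n ?n"
    and XA: "X * A \<in> carrier_mat ?m ?m" and YA: "Y * A \<in> carrier_mat ?m ?m"
    using A X Y by auto
  have "A * X = mat_adjoint (A * Y * (A * X))"
    using X(2,4) Y(2) assoc_mult_mat[OF AY A X(1)] by simp
  also have "\<dots> = A * X * (A * Y)"
    by (subst mat_adjoint_mult) (use X(4) Y(1,4) in \<open>simp_all only: index_mult_mat carrier_matD\<close>)
  also have "\<dots> = A * Y" using assoc_mult_mat[OF AX A Y(1)] X(2) by simp
  finally have 1: "A * X = A * Y" .
  have "X * A = mat_adjoint (X * A * (Y * A))"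
    using X(5) Y(2) assoc_mult_mat[OF X(1) A YA] assoc_mult_mat[OF A Y(1) A] by simp
  also have "\<dots> = Y * A * (X * A)"
    by (subst mat_adjoint_mult) (use X(5) Y(1,5) in \<open>simp_all only: index_mult_mat carrier_matD\<close>)
  also have "\<dots> = Y * A"
    using assoc_mult_mat[OF Y(1) A XA] assoc_mult_mat[OF A X(1) A] X(2) by simp
  finally have 2: "X * A = Y * A" .
  have "X = X * (A * X)" using X(3) assoc_mult_mat[OF X(1) A X(1)] by simp
  also have "\<dots> = Y * A * Y" using 1 2 assoc_mult_mat[OF X(1) A Y(1)] by simp
  finally show ?thesis using Y(3) by simp
qed

lemma mp_inverse_eqI: "is_mp_inverse A X \<Longrightarrow> mp_inverse A = X"
  unfolding mp_inverse_def using is_mp_inverse_unique by blast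

section \<open>Inclusions of ranges as factorizations\<close>

lemma right_range_subset_iff:
  assumes X: "X \<in> carrier_mat n m" and A: "A \<in> carrier_mat n k"
  shows "right_range X \<subseteq> right_range A \<longleftrightarrow> (\<exists>Z \<in> carrier_mat k m. X = A * Z)"
proof
  assume sub: "right_range X \<subseteq> right_range A"
  \<comment> \<open>Testing the inclusion on unit vectors writes each column of \<open>X\<close> as
    \<open>A z\<close>; these \<open>z\<close> become the columns of \<open>Z\<close>.\<close>
  have "\<exists>z \<in> carrier_vec k. col X j = A *\<^sub>v z" if j: "j < m" for j
  proof -
    let ?e = "mat_of_cols m [unit_vec m j]"
    have e: "?e \<in> carrier_mat m 1" by auto
    have "X * ?e \<in> right_range X" using X e unfolding right_range_def by blast
    then obtain z where z: "z \<in> carrier_mat k 1" "X * ?e = A * z"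
      using sub A unfolding right_range_def by auto
    have "col X j = col (X * ?e) 0"
      using X j mult_mat_unit_vec[OF X j] by (subst col_mult2[OF X e]) auto
    also have "\<dots> = A *\<^sub>v col z 0" unfolding z(2) using A z(1) by (intro col_mult2) auto
    finally show ?thesis using z(1) by (intro bexI[of _ "col z 0"]) auto
  qed
  then obtain z where z: "\<And>j. j < m \<Longrightarrow> z j \<in> carrier_vec k" "\<And>j. j < m \<Longrightarrow> col X j = A *\<^sub>v z j"
    using bchoice[of "{..<m}" "\<lambda>j x. x \<in> carrier_vec k \<and> col X j = A *\<^sub>v x"]
    by (metis lessThan_iff)
  define Z where "Z = mat k m (\<lambda>(i, j). z j $ i)"
  have Z: "Z \<in> carrier_mat k m" by (simp add: Z_def)
  have "col Z j = z j" if "j < m" for j using z(1)[OF that] that by (auto simp: Z_def)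
  then have "X = A * Z"
    by (intro mat_col_eqI) (use X A Z z(2) in auto)
  then show "\<exists>Z \<in> carrier_mat k m. X = A * Z" using Z by blast
next
  assume "\<exists>Z \<in> carrier_mat k m. X = A * Z"
  then obtain Z where Z: "Z \<in> carrier_mat k m" "X = A * Z" by blast
  have "X * x \<in> right_range A" if x: "x \<in> carrier_mat m 1" for x
  proof -
    have "X * x = A * (Z * x)" unfolding Z(2) by (rule assoc_mult_mat[OF A Z(1) x])
    moreover have "Z * x \<in> carrier_mat (dim_col A) 1" using Z A x by auto
    ultimately show ?thesis unfolding right_range_def by blast
  qed
  then show "right_range X \<subseteq> right_range A" using X unfolding right_range_def by auto
qed

text \<open>Carries the factorization criterion over from column spaces to row spaces.\<close>

lemma left_range_eq_right_range_transpose: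
  fixes A :: "complex mat"
  shows "left_range A = transpose_mat ` right_range (transpose_mat A)"
proof (intro equalityI subsetI)
  fix y assume "y \<in> left_range A"
  then obtain x where x: "x \<in> carrier_mat 1 (dim_row A)" "y = x * A" by (auto simp: left_range_def)
  then have "transpose_mat y = transpose_mat A * transpose_mat x" 
    using transpose_mult[OF x(1), of A "dim_col A"] by simp
  moreover have "transpose_mat x \<in> carrier_mat (dim_col (transpose_mat A)) 1" using x by auto
  ultimately have "transpose_mat y \<in> right_range (transpose_mat A)" unfolding right_range_def by blast
  then show "y \<in> transpose_mat ` right_range (transpose_mat A)" by (metis image_eqI transpose_transpose)
next
  fix y assume "y \<in> transpose_mat ` right_range (transpose_mat A)"
  then obtain x where x: "x \<in> carrier_mat (dim_row A) 1" "y = transpose_mat (transpose_mat A * x)"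
    by (auto simp: right_range_def)
  then have "y = transpose_mat x * A"
    by (subst (asm) transpose_mult[of _ "dim_col A" "dim_row A" _ 1]) auto
  moreover have "transpose_mat x \<in> carrier_mat 1 (dim_row A)" using x by auto
  ultimately show "y \<in> left_range A" unfolding left_range_def by blast
qed

lemma left_range_subset_iff:
  assumes X: "X \<in> carrier_mat m n" and A: "A \<in> carrier_mat k n"
  shows "left_range X \<subseteq> left_range A \<longleftrightarrow> (\<exists>Z \<in> carrier_mat m k. X = Z * A)"
proof -
  let ?t = "transpose_mat :: complex mat \<Rightarrow> complex mat"
  have "inj ?t" by (metis injI transpose_transpose)
  then have "left_range X \<subseteq> left_range A \<longleftrightarrow> right_range (?t X) \<subseteq> right_range (?t A)"
    by (simp add: left_range_eq_right_range_transpose inj_image_subset_iff)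
  also have "\<dots> \<longleftrightarrow> (\<exists>Z \<in> carrier_mat k m. ?t X = ?t A * Z)"
    using X A by (intro right_range_subset_iff[of _ n]) auto
  also have "\<dots> \<longleftrightarrow> (\<exists>Z \<in> carrier_mat m k. X = Z * A)"
  proof
    assume "\<exists>Z \<in> carrier_mat k m. ?t X = ?t A * Z"
    then obtain Z where Z: "Z \<in> carrier_mat k m" "?t X = ?t A * Z" by blast
    have "X = ?t (?t A * Z)" using Z(2) by (metis transpose_transpose)
    then have "X = ?t Z * A" using transpose_mult[of "?t A" n k Z m] A Z(1) by simp
    then show "\<exists>Z \<in> carrier_mat m k. X = Z * A" using Z(1) by (intro bexI[of _ "?t Z"]) auto
  next
    assume "\<exists>Z \<in> carrier_mat m k. X = Z * A"
    then obtain Z where Z: "Z \<in> carrier_mat m k" "X = Z * A" by blast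
    then have "?t X = ?t A * ?t Z" using transpose_mult[OF Z(1) A] by simp
    then show "\<exists>Z \<in> carrier_mat k m. ?t X = ?t A * Z" using Z(1) by (intro bexI[of _ "?t Z"]) auto
  qed
  finally show ?thesis .
qed

text \<open>\<open>X = A W\<close> and \<open>X A A = A\<close> give the two inclusions of ranges.
  For uniqueness, a competitor \<open>X' = A Z\<close> equals \<open>X A A Z = X (A X')\<close>, and
  \<open>A X'\<close> is prescribed; so \<open>X'\<close> is determined by \<open>X\<close> and
  \<open>A\<close>, and \<open>X\<close> satisfies the same formula.\<close>

lemma right_core_inverse_eqI:
  assumes A: "A \<in> carrier_mat n n" and X: "X \<in> carrier_mat n n"
    and AX: "A * X = A * mp_inverse A" and W: "W \<in> carrier_mat n n" and XW: "X = A * W"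
    and XAA: "X * (A * A) = A"
  shows "right_core_inverse A = X"
  unfolding right_core_inverse_def
proof (rule the_equality)
  have AA: "A * A \<in> carrier_mat n n" using A by simp
  have "right_range X \<subseteq> right_range A"
    using right_range_subset_iff[OF X A] W XW by blast
  moreover have "right_range A \<subseteq> right_range X"
    unfolding right_range_subset_iff[OF A X] using AA XAA by metis
  ultimately show "is_right_core_inverse A X"
    using A X AX by (simp add: is_right_core_inverse_def)
  have fixed: "X' = X * (A * mp_inverse A)" if "is_right_core_inverse A X'" for X'
  proof -
    have X': "X' \<in> carrier_mat n n" "A * X' = A * mp_inverse A" "right_range X' \<subseteq> right_range A"
      using that A by (auto simp: is_right_core_inverse_def)
    then obtain Z where Z: "Z \<in> carrier_mat n n" "X' = A * Z"
      using right_range_subset_iff[OF X'(1) A] by blast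
    have "X' = X * (A * A) * Z" using Z XAA by simp
    also have "\<dots> = X * (A * A * Z)" by (rule assoc_mult_mat[OF X AA Z(1)])
    also have "A * A * Z = A * X'" using assoc_mult_mat[OF A A Z(1)] Z(2) by simp
    finally show ?thesis using X'(2) by simp
  qed
  fix X' assume "is_right_core_inverse A X'"
  then show "X' = X" using fixed \<open>is_right_core_inverse A X\<close> by metis
qed

text \<open>Mirror image: a competitor \<open>Y' = Z A\<close> equals \<open>Z A A A Y\<close> with
  one \<open>A\<close> absorbed, that is \<open>(Y' A) Y\<close>, where \<open>Y' A\<close> is
  prescribed.\<close>

lemma left_core_inverse_eqI:
  assumes A: "A \<in> carrier_mat n n" and Y: "Y \<in> carrier_mat n n"
    and YA: "Y * A = mp_inverse A * A" and W: "W \<in> carrier_mat n n" and YW: "Y = W * A"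
    and AAY: "A * A * Y = A"
  shows "left_core_inverse A = Y"
  unfolding left_core_inverse_def
proof (rule the_equality)
  have AA: "A * A \<in> carrier_mat n n" using A by simp
  have "left_range Y \<subseteq> left_range A"
    using left_range_subset_iff[OF Y A] W YW by blast
  moreover have "left_range A \<subseteq> left_range Y"
    unfolding left_range_subset_iff[OF A Y] using AA AAY by metis
  ultimately show "is_left_core_inverse A Y"
    using A Y YA by (simp add: is_left_core_inverse_def)
  have fixed: "Y' = mp_inverse A * A * Y" if "is_left_core_inverse A Y'" for Y'
  proof -
    have Y': "Y' \<in> carrier_mat n n" "Y' * A = mp_inverse A * A" "left_range Y' \<subseteq> left_range A"
      using that A by (auto simp: is_left_core_inverse_def)
    then obtain Z where Z: "Z \<in> carrier_mat n n" "Y' = Z * A"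
      using left_range_subset_iff[OF Y'(1) A] by blast
    have ZA: "Z * A \<in> carrier_mat n n" using Z A by simp
    have "Y' = Z * (A * A * Y)" using Z AAY by simp
    also have "\<dots> = Z * A * A * Y"
      using assoc_mult_mat[OF Z(1) AA Y] assoc_mult_mat[OF Z(1) A A] by simp
    finally show ?thesis using Y'(2) Z(2) by simp
  qed
  fix Y' assume "is_left_core_inverse A Y'"
  then show "Y' = Y" using fixed \<open>is_left_core_inverse A Y\<close> by metis
qed

section \<open>Explicit inverses from a rank factorization\<close>

text \<open>\<open>C\<close>, \<open>D\<close> and \<open>H\<close> are the inverses of the Gram
  matrices \<open>Pa P\<close> and \<open>Q Qa\<close> and of \<open>Q P\<close>. Invertibility of
  \<open>Q P\<close> is how the rank condition on \<open>A * A\<close> enters.\<close>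

locale core_factorization =
  fixes A P Q C D H :: "complex mat" and n s :: nat
  assumes A: "A = P * Q" and P: "P \<in> carrier_mat n s" and Q: "Q \<in> carrier_mat s n"
    and C: "C \<in> carrier_mat s s" and D: "D \<in> carrier_mat s s" and H: "H \<in> carrier_mat s s"
    and C_inv: "mat_adjoint P * P * C = 1\<^sub>m s"
    and D_inv: "Q * mat_adjoint Q * D = 1\<^sub>m s"
    and H_inv: "Q * P * H = 1\<^sub>m s"
begin

abbreviation "Pa \<equiv> mat_adjoint P"
abbreviation "Qa \<equiv> mat_adjoint Q"

lemma dims:
  "dim_row P = n" "dim_col P = s" "dim_row Q = s" "dim_col Q = n" "dim_row C = s" "dim_col C = s"
  "dim_row D = s" "dim_col D = s" "dim_row H = s" "dim_col H = s"
  using P Q C D H by auto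

lemma left_inverses: "C * (Pa * P) = 1\<^sub>m s" "D * (Q * Qa) = 1\<^sub>m s" "H * (Q * P) = 1\<^sub>m s"
  by (rule mat_mult_left_right_inverse[OF _ C C_inv] mat_mult_left_right_inverse[OF _ D D_inv]
    mat_mult_left_right_inverse[OF _ H H_inv]; rule carrier_matI; simp only: index_mult_mat mat_adjoint_dim dims)+

lemma inverses: "Pa * (P * C) = 1\<^sub>m s" "Q * (Qa * D) = 1\<^sub>m s" "Q * (P * H) = 1\<^sub>m s"
  by (subst mult_mat_assoc[symmetric];
    simp only: index_mult_mat mat_adjoint_dim dims C_inv D_inv H_inv)+

text \<open>Products are kept nested to the right, so an inverse pair must also cancel in front of
  an arbitrary remainder \<open>X\<close>.\<close>

lemma cancel:
  assumes X: "dim_row X = s"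
  shows "C * (Pa * (P * X)) = X" "D * (Q * (Qa * X)) = X" "H * (Q * (P * X)) = X"
    "Pa * (P * (C * X)) = X" "Q * (Qa * (D * X)) = X" "Q * (P * (H * X)) = X"
proof -
  have *: "U * (V * (W * X)) = X"
    if 1: "U * (V * W) = 1\<^sub>m s" and dim: "dim_col U = dim_row V" "dim_col V = dim_row W" "dim_col W = s"
    for U V W
  proof -
    have "U * (V * (W * X)) = U * (V * W * X)"
      by (subst mult_mat_assoc) (simp_all only: dim X)
    also have "\<dots> = U * (V * W) * X"
      by (subst mult_mat_assoc[of U]) (simp_all only: index_mult_mat dim X)
    also have "\<dots> = X" unfolding 1 by (rule left_mult_one_mat[of _ s "dim_col X"]) (use X in auto)
    finally show ?thesis .
  qed
  show "C * (Pa * (P * X)) = X" "D * (Q * (Qa * X)) = X" "H * (Q * (P * X)) = X"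
    "Pa * (P * (C * X)) = X" "Q * (Qa * (D * X)) = X" "Q * (P * (H * X)) = X"
    by (rule *; simp only: left_inverses inverses mat_adjoint_dim dims)+
qed

text \<open>\<open>Pa P\<close> is self-adjoint, so the adjoint of \<open>C\<close> is again its
  inverse.\<close>

lemma C_adjoint: "mat_adjoint C = C"
proof -
  have "mat_adjoint (C * (Pa * P)) = 1\<^sub>m s" unfolding left_inverses by simp
  then have "Pa * (P * mat_adjoint C) = 1\<^sub>m s"
    by (simp add: dims mult_mat_assoc mat_adjoint_mult)
  then have "C * (Pa * (P * mat_adjoint C)) = C" using right_mult_one_mat[OF C] by (simp only:)
  then show ?thesis by (simp only: cancel dims mat_adjoint_dim)
qed

lemma D_adjoint: "mat_adjoint D = D"
proof -
  have "mat_adjoint (D * (Q * Qa)) = 1\<^sub>m s" unfolding left_inverses by simp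
  then have "Q * (Qa * mat_adjoint D) = 1\<^sub>m s"
    by (simp add: dims mult_mat_assoc mat_adjoint_mult)
  then have "D * (Q * (Qa * mat_adjoint D)) = D" using right_mult_one_mat[OF D] by (simp only:)
  then show ?thesis by (simp only: cancel dims mat_adjoint_dim)
qed

text \<open>A rewriting system for words in the factors: push adjoints inward, nest to the right,
  cancel inverse pairs. It decides the matrix identities and dimension conditions below.\<close>

lemmas mat_simps = dims mult_mat_assoc cancel inverses left_inverses index_mult_mat(2,3)
  mat_adjoint_dim mat_adjoint_mult mat_adjoint_adjoint C_adjoint D_adjoint carrier_mat_def
  mem_Collect_eq simp_thms

text \<open>With this matrix as \<open>X\<close>, \<open>A X\<close> collapses to
  \<open>P C Pa\<close> and \<open>X A\<close> to \<open>Qa D Q\<close>, both self-adjoint since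
  \<open>C\<close> and \<open>D\<close> are.\<close>

lemma mp_inverse: "mp_inverse A = Qa * (D * (C * Pa))"
  by (rule mp_inverse_eqI) (simp only: is_mp_inverse_def A mat_simps)

text \<open>The witness \<open>W\<close> is chosen so that \<open>Q Qa\<close> cancels
  \<open>D\<close> in \<open>A W\<close>; in the left case \<open>C\<close> cancels
  \<open>Pa P\<close> in \<open>W A\<close>, so the same \<open>W\<close> serves.\<close>

lemma right_core_inverse: "right_core_inverse A = P * (H * (C * Pa))"
  by (rule right_core_inverse_eqI[where n = n and W = "Qa * (D * (H * (C * Pa)))"];
    (simp only: mp_inverse)?; simp only: A mat_simps)

lemma left_core_inverse: "left_core_inverse A = Qa * (D * (H * Q))"
  by (rule left_core_inverse_eqI[where n = n and W = "Qa * (D * (H * (C * Pa)))"];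
    (simp only: mp_inverse)?; simp only: A mat_simps)

text \<open>Here and in the next two lemmas the first factor stays \<open>n\<close> by
  \<open>s\<close>, and the \<open>s\<close> by \<open>s\<close> product of the swapped factors is
  inverted by the known inverses in reverse order.\<close>

lemma factor_square: "A * A = P * (Q * P * Q)" "Q * P * Q * P * (H * H) = 1\<^sub>m s"
  by (simp_all only: A mat_simps)

lemma factor_adjoint_right:
  "A * mat_adjoint A = P * (Q * Qa * Pa)" "Q * Qa * Pa * P * (C * D) = 1\<^sub>m s"
  by (simp_all only: A mat_simps)

lemma factor_adjoint_left:
  "mat_adjoint A * A = Qa * (Pa * P * Q)" "Pa * P * Q * Qa * (D * C) = 1\<^sub>m s"
  by (simp_all only: A mat_simps)

end

section \<open>The determinantal representations of both core inverses\<close>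

theorem corollary3p1:
  fixes A :: "complex mat" and n s :: nat
  assumes "A \<in> carrier_mat n n"
    and "vec_space.rank n (A * A) = s"
    and "vec_space.rank n A = s"
    and "s \<ge> 1"
  shows
    "(let X = right_core_inverse A;
          At = A * A * mat_adjoint A;
          v_row = (\<lambda>i. vec n (\<lambda>f.
            \<Sum>\<beta>\<in>ksubsets_containing s n i. principal_minor (replace_col (A * A) (col At f) i) \<beta>));
          v_col = (\<lambda>j. vec n (\<lambda>l.
            \<Sum>\<alpha>\<in>ksubsets_containing s n j.
              principal_minor (replace_row (A * mat_adjoint A) (row At l) j) \<alpha>));
          d = (\<Sum>\<alpha>\<in>ksubsets s n. principal_minor (A * mat_adjoint A) \<alpha>)
              * (\<Sum>\<beta>\<in>ksubsets s n. principal_minor (A * A) \<beta>)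
      in \<forall>i<n. \<forall>j<n.
           X $$ (i, j) =
             (\<Sum>\<alpha>\<in>ksubsets_containing s n j.
                principal_minor (replace_row (A * mat_adjoint A) (v_row i) j) \<alpha>) / d \<and>
           X $$ (i, j) =
             (\<Sum>\<beta>\<in>ksubsets_containing s n i.
                principal_minor (replace_col (A * A) (v_col j) i) \<beta>) / d)
     \<and>
     (let Y = left_core_inverse A;
          Ab = mat_adjoint A * (A * A);
          u_row = (\<lambda>i. vec n (\<lambda>f.
            \<Sum>\<beta>\<in>ksubsets_containing s n i.
              principal_minor (replace_col (mat_adjoint A * A) (col Ab f) i) \<beta>));
          u_col = (\<lambda>j. vec n (\<lambda>l.
            \<Sum>\<alpha>\<in>ksubsets_containing s n j. principal_minor (replace_row (A * A) (row Ab l) j) \<alpha>));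
          d = (\<Sum>\<alpha>\<in>ksubsets s n. principal_minor (A * A) \<alpha>)
              * (\<Sum>\<beta>\<in>ksubsets s n. principal_minor (mat_adjoint A * A) \<beta>)
      in \<forall>i<n. \<forall>j<n.
           Y $$ (i, j) =
             (\<Sum>\<alpha>\<in>ksubsets_containing s n j.
                principal_minor (replace_row (A * A) (u_row i) j) \<alpha>) / d \<and>
           Y $$ (i, j) =
             (\<Sum>\<beta>\<in>ksubsets_containing s n i.
                principal_minor (replace_col (mat_adjoint A * A) (u_col j) i) \<beta>) / d)"
proof -
  note A = assms(1)
  have sn: "s \<le> n" using vec_space.rank_le_nc[OF A] assms(3) by simp
  obtain P Q R where P: "P \<in> carrier_mat n s" and Q: "Q \<in> carrier_mat s n" and R: "R \<in> carrier_mat n s"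
    and APQ: "A = P * Q" and QR: "Q * R = 1\<^sub>m s"
    and Pinj: "\<And>v. v \<in> carrier_vec s \<Longrightarrow> P *\<^sub>v v = 0\<^sub>v n \<Longrightarrow> v = 0\<^sub>v s"
    using rank_factorization[OF A assms(3)] by blast
  \<comment> \<open>\<open>P2 = P (Q P) (Q R2)\<close> is injective, which makes \<open>Q P\<close> invertible.\<close>
  have AA: "A * A \<in> carrier_mat n n" using A by simp
  obtain P2 Q2 R2 where P2: "P2 \<in> carrier_mat n s" and Q2: "Q2 \<in> carrier_mat s n"
    and R2: "R2 \<in> carrier_mat n s" and AA2: "A * A = P2 * Q2" and QR2: "Q2 * R2 = 1\<^sub>m s"
    and P2inj: "\<And>v. v \<in> carrier_vec s \<Longrightarrow> P2 *\<^sub>v v = 0\<^sub>v n \<Longrightarrow> v = 0\<^sub>v s"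
    using rank_factorization[OF AA assms(2)] by blast
  have adj: "mat_adjoint P \<in> carrier_mat s n" "mat_adjoint Q \<in> carrier_mat n s"
    using P Q by (auto intro: mat_adjoint_carrier)
  have PP: "mat_adjoint P * P \<in> carrier_mat s s" and QQ: "Q * mat_adjoint Q \<in> carrier_mat s s"
    and QP: "Q * P \<in> carrier_mat s s" and QR2c: "Q * R2 \<in> carrier_mat s s"
    using P Q R2 adj by auto
  obtain C where C: "C \<in> carrier_mat s s" "mat_adjoint P * P * C = 1\<^sub>m s"
    using inj_square_mat_inverse[OF PP] Pinj adjoint_mult_self_inj[OF P] by metis
  \<comment> \<open>\<open>Q Qa\<close> has the kernel of \<open>Qa\<close>, which is trivial
    because \<open>Q\<close> has a right inverse.\<close>
  have "v = 0\<^sub>v s" if v: "v \<in> carrier_vec s" and z: "Q * mat_adjoint Q *\<^sub>v v = 0\<^sub>v s" for v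
    using adjoint_mult_self_inj[OF adj(2) v] z right_inverse_adjoint_inj[OF Q R QR v] by simp
  then obtain D where D: "D \<in> carrier_mat s s" "Q * mat_adjoint Q * D = 1\<^sub>m s"
    using inj_square_mat_inverse[OF QQ] by metis
  have "P2 = P2 * (Q2 * R2)" using P2 by (simp add: QR2)
  also have "\<dots> = A * A * R2" using P2 Q2 R2 by (simp add: AA2)
  also have "\<dots> = P * (Q * P * (Q * R2))" using P Q R2 by (simp add: APQ mult_mat_assoc del: assoc_mult_mat)
  finally have P2': "P2 = P * (Q * P * (Q * R2))" .
  have "v = 0\<^sub>v s" if v: "v \<in> carrier_vec s" and z: "Q * P * (Q * R2) *\<^sub>v v = 0\<^sub>v s" for v
  proof (rule P2inj[OF v])
    have "P2 *\<^sub>v v = P *\<^sub>v (Q * P * (Q * R2) *\<^sub>v v)"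
      unfolding P2' using QP QR2c v by (intro assoc_mult_mat_vec[OF P]) auto
    then show "P2 *\<^sub>v v = 0\<^sub>v n" unfolding z using mult_mat_zero_vec[OF P] by simp
  qed
  then obtain T where T: "T \<in> carrier_mat s s" "Q * P * (Q * R2) * T = 1\<^sub>m s"
    using inj_square_mat_inverse[of "Q * P * (Q * R2)" s] QP QR2c by (metis mult_carrier_mat)
  \<comment> \<open>\<open>T\<close> inverts \<open>Q P (Q R2)\<close>, so moving the last factor
    over to \<open>T\<close> gives a right inverse of \<open>Q P\<close>.\<close>
  define H where "H = Q * R2 * T"
  have H: "H \<in> carrier_mat s s" "Q * P * H = 1\<^sub>m s"
    using T QP QR2c assoc_mult_mat[OF QP QR2c T(1)] by (auto simp: H_def simp del: assoc_mult_mat)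
  interpret core_factorization A P Q C D H n s
    using APQ P Q C D H by unfold_locales
  \<comment> \<open>\<open>?Z\<close> is the Moore-Penrose inverse of \<open>A\<close>. Inserting it
    between two factors \<open>A\<close> changes nothing, which gives \<open>T1\<close> and
    \<open>T2\<close>.\<close>
  let ?Z = "Qa * (D * (C * Pa))"
  have Z: "?Z \<in> carrier_mat n n" and HH: "H * H \<in> carrier_mat s s" and CD: "C * D \<in> carrier_mat s s"
    and DC: "D * C \<in> carrier_mat s s"
    and fc: "Q * P * Q \<in> carrier_mat s n" "Q * Qa * Pa \<in> carrier_mat s n" "Pa * P * Q \<in> carrier_mat s n"
    by (simp_all only: mat_simps)
  have T1: "A * A * mat_adjoint A = A * A * ?Z * (A * mat_adjoint A)"
    by (simp only: APQ mat_simps)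
  have T2: "mat_adjoint A * (A * A) = mat_adjoint A * A * ?Z * (A * A)"
    by (simp only: APQ mat_simps)
  \<comment> \<open>The outer factors collapse to \<open>P H Q\<close> and \<open>P C Pa\<close>,
    and around \<open>?Z\<close> they leave \<open>P H C Pa\<close>. For \<open>Y\<close> they are
    \<open>Qa D Q\<close> and \<open>P H Q\<close>, leaving \<open>Qa D H Q\<close>.\<close>
  have X: "right_core_inverse A = P * (H * H) * (Q * P * Q) * ?Z * (P * (C * D) * (Q * Qa * Pa))"
    unfolding right_core_inverse by (simp only: mat_simps)
  have Y: "left_core_inverse A = Qa * (D * C) * (Pa * P * Q) * ?Z * (P * (H * H) * (Q * P * Q))"
    unfolding left_core_inverse by (simp only: mat_simps)
  show ?thesis
    unfolding Let_def
    by (intro conjI allI impI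
        double_cramer[OF P fc(1) sn HH factor_square(2) P fc(2) CD factor_adjoint_right(2) Z
          factor_square(1) factor_adjoint_right(1) T1 X]
        double_cramer[OF adj(2) fc(3) sn DC factor_adjoint_left(2) P fc(1) HH factor_square(2) Z
          factor_adjoint_left(1) factor_square(1) T2 Y])
qed

end
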